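(* Let $\{X_{n}\}_{n=1}^{\infty}$ be a sequence of pairwise independent random variables. Suppose there exists a function $H(x)$ which is non-increasing in the interval $x \geq 0$ and such that $$\int_{0}^{\infty} H(x) \, dx < \infty \qquad \text{and} \qquad \sup_{n \geq 1} \frac{1}{n} \sum_{k=1}^{n} P(|X_{k}| > x) \leq H(x) \quad \text{for all } x \geq 0.$$ Then $$\frac{S_{n} - ES_{n}}{n} \to 0 \quad \text{almost surely as } n \to \infty.$$
   Context: The random variables $X_n$, $n \geq 1$, are real-valued and defined on the same probability space; they are not assumed identically distributed. $S_{n}=\sum_{k=1}^{n} X_{k}$, $P$ denotes probability and $E$ denotes expectation. The function $H$ is real-valued and defined on $[0,\infty)$. *)

theory Defs
  imports "HOL-Probability.Probability"
begin

end

theory Submission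
  imports Defs "HOL-Library.Discrete_Functions"
begin

text \<open>
  Etemadi's method. Splitting into positive and negative parts reduces to nonnegative variables,
  since both parts inherit pairwise independence and the tail bound. Truncate by
  \<open>Y k = min (X k) k\<close>; by the layer-cake formula every truncated moment is an integral of tails,
  so the hypothesis bounds averages of moments by integrals of \<open>h\<close>. In particular the variance of
  the average of \<open>Y 1, \<dots>, Y n\<close> is at most \<open>(1/n) \<integral>\<^sub>0\<^sup>n 2 x h(x) dx\<close>, and these bounds are summable
  along \<open>n = \<lceil>\<alpha>^i\<rceil>\<close> because \<open>x\<close> times the sum of \<open>\<alpha>^-i\<close> over \<open>\<alpha>^i \<ge> x / c\<close> is bounded. This
  gives convergence along geometric subsequences. Without identical distributions, the gaps are
  filled using \<open>E Y k \<le> A + E (X k - A)\<^sup>+\<close>, where the averages of \<open>E (X k - A)\<^sup>+\<close> are at most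
  \<open>\<integral>\<^sub>A\<^sup>\<infinity> h\<close>: first \<open>A\<close> is chosen large, then \<open>\<alpha>\<close> close to 1.
\<close>

section \<open>Geometric sums and weighted integrals\<close>

text \<open>The indicator removes every term before the first index \<open>N\<close> with
  \<open>x \<le> c * \<alpha> ^ N\<close>. From \<open>N\<close> on, the terms are dominated by a
  geometric series with first term \<open>c\<close> and ratio \<open>1 / \<alpha>\<close>, so the
  bound is uniform in \<open>x\<close>.\<close>

lemma suminf_geometric_indicator_le:
  fixes \<alpha> c x :: real
  assumes "\<alpha> > 1" "c > 0" "x \<ge> 0"
  shows "(\<Sum>n. ennreal (x / \<alpha> ^ n * indicator {0..c * \<alpha> ^ n} x)) \<le> ennreal (c * \<alpha> / (\<alpha> - 1))"
proof -
  define N where "N = (LEAST n. x \<le> c * \<alpha> ^ n)"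
  obtain n0 where "x / c < \<alpha> ^ n0"
    using real_arch_pow[OF assms(1)] by blast
  then have "x \<le> c * \<alpha> ^ n0"
    using assms by (simp add: field_simps)
  then have N: "x \<le> c * \<alpha> ^ N"
    unfolding N_def by (rule LeastI)
  define f where "f n = (if n < N then 0 else c * \<alpha> ^ N / \<alpha> ^ n)" for n
  have "(\<lambda>i. c * (1 / \<alpha>) ^ i) sums (c * (1 / (1 - 1 / \<alpha>)))"
    using assms by (intro sums_mult geometric_sums) auto
  moreover have "f (i + N) = c * (1 / \<alpha>) ^ i" for i
    using assms by (simp add: f_def power_add field_simps)
  moreover have "c * (1 / (1 - 1 / \<alpha>)) = c * \<alpha> / (\<alpha> - 1)"
    using assms by (simp add: field_simps)
  ultimately have "(\<lambda>i. f (i + N)) sums (c * \<alpha> / (\<alpha> - 1))"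
    by simp
  then have f: "f sums (c * \<alpha> / (\<alpha> - 1))"
    by (subst (asm) sums_zero_iff_shift) (auto simp: f_def)
  have f_nonneg: "0 \<le> f n" for n
    using assms by (simp add: f_def)
  have "x / \<alpha> ^ n * indicator {0..c * \<alpha> ^ n} x \<le> f n" for n
  proof (cases "n < N")
    case True
    then have "\<not> x \<le> c * \<alpha> ^ n"
      unfolding N_def by (rule not_less_Least)
    then show ?thesis
      using f_nonneg by (simp add: indicator_def)
  next
    case False
    then show ?thesis
      using assms N by (auto simp: f_def indicator_def divide_right_mono)
  qed
  then have "(\<Sum>n. ennreal (x / \<alpha> ^ n * indicator {0..c * \<alpha> ^ n} x)) \<le> (\<Sum>n. ennreal (f n))"
    by (intro suminf_le ennreal_leI) auto
  also have "\<dots> = ennreal (c * \<alpha> / (\<alpha> - 1))"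
    by (rule suminf_ennreal_eq[OF f_nonneg f])
  finally show ?thesis .
qed

text \<open>Exchanging sum and integral collects the weights in front of \<open>h x\<close> into a
  series that the preceding lemma bounds independently of \<open>x\<close>. This is how
  integrability of \<open>h\<close> becomes summability of variances.\<close>

lemma suminf_weighted_integral_le:
  fixes h :: "real \<Rightarrow> real" and \<alpha> c :: real
  assumes [measurable]: "h \<in> borel_measurable borel" and "\<alpha> > 1" "c > 0" "\<And>x. 0 \<le> h x"
  shows "(\<Sum>n. ennreal (1 / \<alpha> ^ n) *
             (\<integral>\<^sup>+x. ennreal (2 * x) * indicator {0..c * \<alpha> ^ n} x * ennreal (h x) \<partial>lborel))
           \<le> ennreal (2 * c * \<alpha> / (\<alpha> - 1)) * (\<integral>\<^sup>+x\<in>{0..}. ennreal (h x) \<partial>lborel)"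
proof -
  let ?f = "\<lambda>n x. ennreal (1 / \<alpha> ^ n) * (ennreal (2 * x) * indicator {0..c * \<alpha> ^ n} x * ennreal (h x))"
  have "(\<Sum>n. ennreal (1 / \<alpha> ^ n) *
             (\<integral>\<^sup>+x. ennreal (2 * x) * indicator {0..c * \<alpha> ^ n} x * ennreal (h x) \<partial>lborel))
      = (\<Sum>n. \<integral>\<^sup>+x. ?f n x \<partial>lborel)"
    by (intro suminf_cong nn_integral_cmult[symmetric]) measurable
  also have "\<dots> = (\<integral>\<^sup>+x. (\<Sum>n. ?f n x) \<partial>lborel)"
    by (rule nn_integral_suminf[symmetric]) measurable
  also have "\<dots> \<le> (\<integral>\<^sup>+x. ennreal (2 * c * \<alpha> / (\<alpha> - 1)) * (ennreal (h x) * indicator {0..} x) \<partial>lborel)"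
  proof (rule nn_integral_mono)
    fix x :: real
    show "(\<Sum>n. ?f n x) \<le> ennreal (2 * c * \<alpha> / (\<alpha> - 1)) * (ennreal (h x) * indicator {0..} x)"
    proof (cases "x \<ge> 0")
      case False
      then show ?thesis by (simp add: indicator_def)
    next
      case True
      have "?f n x = ennreal (2 * h x) * ennreal (x / \<alpha> ^ n * indicator {0..c * \<alpha> ^ n} x)" for n
        using assms True by (auto simp: indicator_def ennreal_mult[symmetric])
      then have "(\<Sum>n. ?f n x) = ennreal (2 * h x) * (\<Sum>n. ennreal (x / \<alpha> ^ n * indicator {0..c * \<alpha> ^ n} x))"
        by simp
      also have "\<dots> \<le> ennreal (2 * h x) * ennreal (c * \<alpha> / (\<alpha> - 1))"
        by (intro mult_left_mono suminf_geometric_indicator_le) (use assms True in auto)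
      also have "\<dots> = ennreal (2 * c * \<alpha> / (\<alpha> - 1)) * (ennreal (h x) * indicator {0..} x)"
        using assms True by (simp add: ennreal_mult[symmetric] mult_ac)
      finally show ?thesis .
    qed
  qed
  also have "\<dots> = ennreal (2 * c * \<alpha> / (\<alpha> - 1)) * (\<integral>\<^sup>+x\<in>{0..}. ennreal (h x) \<partial>lborel)"
    by (rule nn_integral_cmult) measurable
  finally show ?thesis .
qed

section \<open>Layer-cake formula and pairwise independent sums\<close>

text \<open>Tonelli on the region \<open>x < X \<omega>\<close>. The weight \<open>g\<close> stays
  free so that one statement serves both second moments (\<open>g x = 2 * x\<close> on a bounded
  interval) and excesses over a level \<open>a\<close> (\<open>g\<close> the indicator of
  \<open>{a..}\<close>).\<close>

lemma (in prob_space) nn_integral_layer_cake: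
  fixes g :: "real \<Rightarrow> ennreal"
  assumes [measurable]: "g \<in> borel_measurable borel" "X \<in> borel_measurable M"
  shows "(\<integral>\<^sup>+\<omega>. \<integral>\<^sup>+x. g x * indicator {..<X \<omega>} x \<partial>lborel \<partial>M)
       = (\<integral>\<^sup>+x. g x * emeasure M {\<omega> \<in> space M. x < X \<omega>} \<partial>lborel)"
proof -
  interpret P: pair_sigma_finite lborel M ..
  have "(\<integral>\<^sup>+\<omega>. \<integral>\<^sup>+x. g x * indicator {..<X \<omega>} x \<partial>lborel \<partial>M)
      = (\<integral>\<^sup>+\<omega>. \<integral>\<^sup>+x. g x * (if x < X \<omega> then 1 else 0) \<partial>lborel \<partial>M)"
    by (simp add: indicator_def of_bool_def)
  also have "\<dots> = (\<integral>\<^sup>+x. \<integral>\<^sup>+\<omega>. g x * (if x < X \<omega> then 1 else 0) \<partial>M \<partial>lborel)"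
    by (rule P.Fubini') measurable
  also have "\<dots> = (\<integral>\<^sup>+x. g x * emeasure M {\<omega> \<in> space M. x < X \<omega>} \<partial>lborel)"
  proof (rule nn_integral_cong)
    fix x
    have "(\<integral>\<^sup>+\<omega>. (if x < X \<omega> then 1 else 0) \<partial>M) = (\<integral>\<^sup>+\<omega>. indicator {\<omega> \<in> space M. x < X \<omega>} \<omega> \<partial>M)"
      by (rule nn_integral_cong) (auto simp: indicator_def)
    then show "(\<integral>\<^sup>+\<omega>. g x * (if x < X \<omega> then 1 else 0) \<partial>M) = g x * emeasure M {\<omega> \<in> space M. x < X \<omega>}"
      by (subst nn_integral_cmult) auto
  qed
  finally show ?thesis .
qed

text \<open>Expanding the square leaves products of at most two centred variables, so pairwise
  independence suffices to kill the cross terms. The diagonal terms are variances, each at most the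
  second moment.\<close>

lemma (in prob_space) expectation_square_centered_sum_le:
  fixes Y :: "nat \<Rightarrow> 'a \<Rightarrow> real"
  assumes fin: "finite I"
    and meas: "\<And>i. i \<in> I \<Longrightarrow> Y i \<in> borel_measurable M"
    and sq: "\<And>i. i \<in> I \<Longrightarrow> integrable M (\<lambda>\<omega>. (Y i \<omega>)\<^sup>2)"
    and ind: "pairwise (\<lambda>i j. indep_var borel (Y i) borel (Y j)) I"
  shows "integrable M (\<lambda>\<omega>. ((\<Sum>i\<in>I. Y i \<omega>) - (\<Sum>i\<in>I. expectation (Y i)))\<^sup>2)"
    and "expectation (\<lambda>\<omega>. ((\<Sum>i\<in>I. Y i \<omega>) - (\<Sum>i\<in>I. expectation (Y i)))\<^sup>2)
           \<le> (\<Sum>i\<in>I. expectation (\<lambda>\<omega>. (Y i \<omega>)\<^sup>2))"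
proof -
  define Z where "Z i \<omega> = Y i \<omega> - expectation (Y i)" for i \<omega>
  have intY: "integrable M (Y i)" if "i \<in> I" for i
    using square_integrable_imp_integrable[OF meas[OF that] sq[OF that]] .
  have intZ: "integrable M (Z i)" if "i \<in> I" for i
    unfolding Z_def using intY[OF that] by simp
  have EZ: "expectation (Z i) = 0" if "i \<in> I" for i
    unfolding Z_def using intY[OF that] by (simp add: prob_space)
  have Z2: "integrable M (\<lambda>\<omega>. Z i \<omega> * Z i \<omega>)" if "i \<in> I" for i
    unfolding Z_def using intY[OF that] sq[OF that]
    by (simp add: algebra_simps power2_eq_square)
  have EZ2: "expectation (\<lambda>\<omega>. Z i \<omega> * Z i \<omega>) \<le> expectation (\<lambda>\<omega>. (Y i \<omega>)\<^sup>2)" if "i \<in> I" for i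
    using variance_eq[OF intY[OF that] sq[OF that]] unfolding Z_def
    by (simp add: power2_eq_square)
  have indZ: "indep_var borel (Z i) borel (Z j)" if "i \<in> I" "j \<in> I" "i \<noteq> j" for i j
  proof -
    have "indep_var borel (Y i) borel (Y j)"
      using ind that by (auto simp: pairwise_def)
    then have "indep_var borel ((\<lambda>y. y - expectation (Y i)) \<circ> Y i) borel ((\<lambda>y. y - expectation (Y j)) \<circ> Y j)"
      by (rule indep_var_compose) measurable
    then show ?thesis
      by (simp add: Z_def[abs_def] comp_def)
  qed
  have int: "integrable M (\<lambda>\<omega>. Z i \<omega> * Z j \<omega>)" if "i \<in> I" "j \<in> I" for i j
    using Z2 indep_var_integrable[OF indZ intZ intZ] that by (cases "i = j") auto
  have cross: "expectation (\<lambda>\<omega>. Z i \<omega> * Z j \<omega>) = 0" if "i \<in> I" "j \<in> I" "i \<noteq> j" for i j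
    using indep_var_lebesgue_integral[OF indZ intZ intZ] EZ that by simp
  have eq: "((\<Sum>i\<in>I. Y i \<omega>) - (\<Sum>i\<in>I. expectation (Y i)))\<^sup>2 = (\<Sum>i\<in>I. \<Sum>j\<in>I. Z i \<omega> * Z j \<omega>)" for \<omega>
    by (simp add: Z_def sum_subtractf power2_eq_square flip: sum_product)
  show "integrable M (\<lambda>\<omega>. ((\<Sum>i\<in>I. Y i \<omega>) - (\<Sum>i\<in>I. expectation (Y i)))\<^sup>2)"
    unfolding eq by (intro Bochner_Integration.integrable_sum int)
  have "expectation (\<lambda>\<omega>. ((\<Sum>i\<in>I. Y i \<omega>) - (\<Sum>i\<in>I. expectation (Y i)))\<^sup>2)
      = (\<Sum>i\<in>I. \<Sum>j\<in>I. expectation (\<lambda>\<omega>. Z i \<omega> * Z j \<omega>))"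
    unfolding eq by (simp add: Bochner_Integration.integral_sum int)
  also have "\<dots> = (\<Sum>i\<in>I. \<Sum>j\<in>I. if i = j then expectation (\<lambda>\<omega>. Z i \<omega> * Z i \<omega>) else 0)"
    by (intro sum.cong) (auto simp: cross)
  also have "\<dots> = (\<Sum>i\<in>I. expectation (\<lambda>\<omega>. Z i \<omega> * Z i \<omega>))"
    using fin by simp
  also have "\<dots> \<le> (\<Sum>i\<in>I. expectation (\<lambda>\<omega>. (Y i \<omega>)\<^sup>2))"
    by (intro sum_mono EZ2)
  finally show "expectation (\<lambda>\<omega>. ((\<Sum>i\<in>I. Y i \<omega>) - (\<Sum>i\<in>I. expectation (Y i)))\<^sup>2)
      \<le> (\<Sum>i\<in>I. expectation (\<lambda>\<omega>. (Y i \<omega>)\<^sup>2))" .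
qed

section \<open>Almost sure convergence and interpolation between subsequence terms\<close>

text \<open>The random series of squares has finite expectation, hence converges almost surely, and
  so its terms vanish. This takes the place of Chebyshev followed by Borel-Cantelli.\<close>

lemma AE_tendsto_zero_of_suminf_square:
  fixes Z :: "nat \<Rightarrow> 'a \<Rightarrow> real"
  assumes [measurable]: "\<And>n. Z n \<in> borel_measurable M"
    and fin: "(\<Sum>n. \<integral>\<^sup>+\<omega>. ennreal ((Z n \<omega>)\<^sup>2) \<partial>M) < \<infinity>"
  shows "AE \<omega> in M. (\<lambda>n. Z n \<omega>) \<longlonglongrightarrow> 0"
proof -
  have "(\<integral>\<^sup>+\<omega>. (\<Sum>n. ennreal ((Z n \<omega>)\<^sup>2)) \<partial>M) = (\<Sum>n. \<integral>\<^sup>+\<omega>. ennreal ((Z n \<omega>)\<^sup>2) \<partial>M)"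
    by (rule nn_integral_suminf) measurable
  then have "AE \<omega> in M. (\<Sum>n. ennreal ((Z n \<omega>)\<^sup>2)) \<noteq> \<infinity>"
    using fin by (intro nn_integral_PInf_AE) auto
  then show ?thesis
  proof eventually_elim
    case (elim \<omega>)
    then have "summable (\<lambda>n. (Z n \<omega>)\<^sup>2)"
      by (intro summable_suminf_not_top) auto
    then have "(\<lambda>n. (Z n \<omega>)\<^sup>2) \<longlonglongrightarrow> 0"
      by (rule summable_LIMSEQ_zero)
    then show ?case
      using tendsto_real_sqrt[of "\<lambda>n. (Z n \<omega>)\<^sup>2" 0] by (simp add: tendsto_rabs_zero_iff)
  qed
qed

text \<open>For \<open>n\<close> between consecutive subsequence indices, monotonicity traps
  \<open>s n - a n\<close> between the deviations at the two ends, up to the increment of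
  \<open>a\<close> over the block. In the identically distributed case that increment is controlled
  by linear growth of \<open>a\<close>; here \<open>osc\<close> replaces it. The ratios
  \<open>1 + 1 / Suc j\<close> form a countable family tending to 1, so that only countably many
  null sets arise in the application.\<close>

lemma geometric_subsequence_sandwich:
  fixes s a :: "nat \<Rightarrow> real"
  assumes s: "mono s" and a: "mono a"
    and osc: "\<And>r::real. r > 0 \<Longrightarrow> \<exists>A\<ge>0. \<forall>m n. m \<le> n \<longrightarrow> a n - a m \<le> A * real (n - m) + r * real n"
    and lim: "\<And>j. (\<lambda>i. (s (nat \<lceil>(1 + 1 / Suc j) ^ i\<rceil>) - a (nat \<lceil>(1 + 1 / Suc j) ^ i\<rceil>))
                      / real (nat \<lceil>(1 + 1 / Suc j) ^ i\<rceil>)) \<longlonglongrightarrow> 0"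
  shows "(\<lambda>n. (s n - a n) / n) \<longlonglongrightarrow> 0"
proof (rule LIMSEQ_I)
  fix \<epsilon> :: real
  assume \<epsilon>: "\<epsilon> > 0"
  \<comment> \<open>Error budget in units of \<open>\<epsilon> * k i\<close>: the block increment of
    \<open>a\<close> costs 1/8 + 1/8 + 3/16 = 7/16 and the deviation at an end at most 3/8, in total
    13/16.\<close>
  obtain A where A: "A \<ge> 0" "\<And>m n. m \<le> n \<Longrightarrow> a n - a m \<le> A * real (n - m) + \<epsilon> / 16 * n"
    using osc[of "\<epsilon> / 16"] \<epsilon> by auto
  \<comment> \<open>\<open>A\<close> depends on \<open>\<epsilon>\<close> only; the ratio is now
    taken close enough to 1 that \<open>A * (\<alpha> - 1) \<le> \<epsilon> / 8\<close>.\<close>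
  obtain j where j: "real j > 8 * A / \<epsilon>"
    using reals_Archimedean2 by blast
  define \<alpha> where "\<alpha> = 1 + 1 / real (Suc j)"
  define k where "k i = nat \<lceil>\<alpha> ^ i\<rceil>" for i
  have \<alpha>: "1 < \<alpha>" "\<alpha> \<le> 2"
    by (auto simp: \<alpha>_def)
  have "8 * A < \<epsilon> * Suc j"
    using j \<epsilon> by (simp add: field_simps)
  then have A\<alpha>: "A * (\<alpha> - 1) \<le> \<epsilon> / 8"
    by (simp add: \<alpha>_def field_simps)
  have pow: "1 \<le> \<alpha> ^ i" for i
    using \<alpha> by simp
  have kge: "\<alpha> ^ i \<le> k i" for i
    unfolding k_def by linarith
  have kle: "k i \<le> \<alpha> ^ i + 1" for i
    unfolding k_def using pow[of i] by linarith
  have k1: "1 \<le> k i" for i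
    using kge[of i] pow[of i] by linarith
  have kSuc: "k (Suc i) \<le> \<alpha> * k i + 1" for i
  proof -
    have "\<alpha> * \<alpha> ^ i \<le> \<alpha> * k i"
      using kge[of i] \<alpha> by (intro mult_left_mono) auto
    then show ?thesis
      using kle[of "Suc i"] by simp
  qed
  have kmono: "mono k"
    unfolding k_def using \<alpha> by (intro monoI nat_mono ceiling_mono power_increasing) auto
  have "(\<lambda>i. (s (k i) - a (k i)) / k i) \<longlonglongrightarrow> 0"
    using lim[of j] unfolding k_def \<alpha>_def by simp
  then have "\<exists>I1. \<forall>i\<ge>I1. norm ((s (k i) - a (k i)) / k i - 0) < \<epsilon> / 8"
    using \<epsilon> by (intro LIMSEQ_D) auto
  then obtain I1 where I1: "\<And>i. i \<ge> I1 \<Longrightarrow> \<bar>(s (k i) - a (k i)) / k i\<bar> < \<epsilon> / 8"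
    unfolding diff_zero real_norm_def by blast
  \<comment> \<open>Rounding up makes a block longer by at most 1, which costs an extra
    \<open>A\<close>. Beyond \<open>I2\<close> this is at most
    \<open>\<epsilon> / 8 * k i\<close>.\<close>
  obtain I2 where I2: "8 * A / \<epsilon> < \<alpha> ^ I2"
    using real_arch_pow[OF \<alpha>(1)] by blast
  define I where "I = max I1 I2"
  show "\<exists>n0. \<forall>n\<ge>n0. norm ((s n - a n) / n - 0) < \<epsilon>"
  proof (intro exI[of _ "k I"] allI impI)
    fix n
    assume n: "k I \<le> n"
    obtain n0 where "real n < \<alpha> ^ n0"
      using real_arch_pow[OF \<alpha>(1)] by blast
    then have ex: "n < k n0"
      using kge[of n0] by linarith
    \<comment> \<open>The first index with \<open>k l\<close> above \<open>n\<close> exceeds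
      \<open>I\<close>, so it is a successor \<open>Suc i\<close> and
      \<open>k i \<le> n < k (Suc i)\<close>.\<close>
    define l where "l = (LEAST l. n < k l)"
    have l: "n < k l"
      unfolding l_def using ex by (rule LeastI)
    have "I < l"
      using l n monoD[OF kmono, of l I] by (meson leD le_less_trans not_le_imp_less)
    then obtain i where i: "l = Suc i" "I \<le> i"
      by (cases l) auto
    have ki: "k i \<le> n"
      using not_less_Least[of i "\<lambda>l. n < k l"] i(1) unfolding l_def[symmetric] by simp
    define D where "D = a (k (Suc i)) - a (k i)"
    have "\<alpha> ^ I2 \<le> \<alpha> ^ i"
      using i(2) \<alpha> by (intro power_increasing) (auto simp: I_def)
    then have "8 * A / \<epsilon> \<le> k i"
      using I2 kge[of i] by linarith
    then have Ak: "A \<le> \<epsilon> / 8 * k i"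
      using \<epsilon> by (simp add: field_simps)
    have mono1: "k i \<le> k (Suc i)"
      using kmono by (simp add: monoD)
    have k4: "k (Suc i) \<le> 3 * real (k i)"
    proof -
      have "\<alpha> * k i \<le> 2 * real (k i)"
        using \<alpha> by (intro mult_right_mono) auto
      moreover have "1 \<le> real (k i)"
        using k1[of i] by simp
      ultimately show ?thesis
        using kSuc[of i] by linarith
    qed
    have "D \<le> A * real (k (Suc i) - k i) + \<epsilon> / 16 * k (Suc i)"
      unfolding D_def by (rule A(2)[OF mono1])
    moreover have "A * real (k (Suc i) - k i) \<le> A * ((\<alpha> - 1) * k i + 1)"
      using A(1) kSuc[of i] mono1 by (intro mult_left_mono) (auto simp: algebra_simps of_nat_diff)
    moreover have "A * ((\<alpha> - 1) * k i + 1) = (A * (\<alpha> - 1)) * k i + A"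
      by (simp add: algebra_simps)
    moreover have "(A * (\<alpha> - 1)) * k i \<le> \<epsilon> / 8 * k i"
      by (rule mult_right_mono[OF A\<alpha>]) simp
    moreover have "\<epsilon> / 16 * k (Suc i) \<le> \<epsilon> / 16 * (3 * k i)"
      using k4 \<epsilon> by (intro mult_left_mono) auto
    ultimately have D: "D \<le> 7 / 16 * (\<epsilon> * k i)"
      using Ak by simp
    have d: "\<bar>s (k q) - a (k q)\<bar> \<le> \<epsilon> / 8 * k q" if "q \<ge> i" for q
    proof -
      have "\<bar>s (k q) - a (k q)\<bar> / k q < \<epsilon> / 8"
        using I1[of q] that i by (simp add: I_def abs_divide)
      then show ?thesis
        using k1[of q] by (simp add: pos_divide_less_eq)
    qed
    have d1: "\<bar>s (k i) - a (k i)\<bar> \<le> \<epsilon> / 8 * k i"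
      by (rule d) simp
    have "\<bar>s (k (Suc i)) - a (k (Suc i))\<bar> \<le> \<epsilon> / 8 * k (Suc i)"
      by (rule d) simp
    also have "\<dots> \<le> \<epsilon> / 8 * (3 * k i)"
      using k4 \<epsilon> by (intro mult_left_mono) auto
    finally have d2: "\<bar>s (k (Suc i)) - a (k (Suc i))\<bar> \<le> 3 / 8 * (\<epsilon> * k i)"
      by simp
    \<comment> \<open>Upper bound: \<open>s n - a n \<le> s (k (Suc i)) - a (k i)\<close>, the
      deviation at \<open>k (Suc i)\<close> plus \<open>D\<close>. Lower bound:
      \<open>s (k i) - a (k (Suc i))\<close>, the deviation at \<open>k i\<close> minus
      \<open>D\<close>.\<close>
    have "s (k i) \<le> s n" "s n \<le> s (k (Suc i))" "a (k i) \<le> a n" "a n \<le> a (k (Suc i))"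
      using s a ki l i by (auto simp: monoD)
    then have "\<bar>s n - a n\<bar> \<le> 13 / 16 * (\<epsilon> * k i)"
      using d1 d2 D unfolding D_def by linarith
    also have "\<dots> < \<epsilon> * k i"
      using \<epsilon> k1[of i] by simp
    also have "\<dots> \<le> \<epsilon> * n"
      using \<epsilon> ki by simp
    finally show "norm ((s n - a n) / n - 0) < \<epsilon>"
      using k1[of i] ki by (simp add: field_simps)
  qed
qed

section \<open>Layer-cake integrals for excesses and truncated squares\<close>

lemma nn_integral_indicator_excess:
  fixes a y :: real
  shows "(\<integral>\<^sup>+x. indicator {a..} x * indicator {..<y} x \<partial>lborel) = ennreal (max 0 (y - a))"
proof -
  have "(\<integral>\<^sup>+x. indicator {a..} x * indicator {..<y} x \<partial>lborel)
      = (\<integral>\<^sup>+x. indicator {a..<y} x \<partial>lborel)"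
    by (rule nn_integral_cong) (auto simp: indicator_def)
  also have "\<dots> = ennreal (max 0 (y - a))"
    by (cases "a \<le> y") auto
  finally show ?thesis .
qed

lemma square_min_le_nn_integral:
  fixes y b :: real
  assumes "0 \<le> y" "0 \<le> b"
  shows "ennreal ((min y b)\<^sup>2)
    \<le> (\<integral>\<^sup>+x. ennreal (2 * x) * indicator {0..b} x * indicator {..<y} x \<partial>lborel)"
proof -
  let ?m = "min y b"
  have "(\<integral>\<^sup>+x\<in>{0..?m}. ennreal (2 * x) \<partial>lborel) = ennreal (?m\<^sup>2 - 0\<^sup>2)"
    using assms by (intro nn_integral_FTC_Icc) (auto intro!: derivative_eq_intros)
  then have "ennreal (?m\<^sup>2) = (\<integral>\<^sup>+x\<in>{0..?m}. ennreal (2 * x) \<partial>lborel)"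
    by simp
  also have "\<dots> \<le> (\<integral>\<^sup>+x. ennreal (2 * x) * indicator {0..b} x * indicator {..<y} x \<partial>lborel)"
  \<comment> \<open>The strict bound in \<open>{..<y}\<close> makes the pointwise inequality fail
    only possibly at \<open>x = y\<close>, a null set.\<close>
  proof (rule nn_integral_mono_AE)
    show "AE x in lborel. ennreal (2 * x) * indicator {0..?m} x
        \<le> ennreal (2 * x) * indicator {0..b} x * indicator {..<y} x"
      using AE_lborel_singleton[of y] by eventually_elim (auto simp: indicator_def)
  qed
  finally show ?thesis .
qed

section \<open>Nonnegative variables with averaged tail bounds\<close>

text \<open>Nonnegativity makes partial sums monotone, as the interpolation requires. Monotonicity
  of \<open>h\<close> on the whole line gives Borel measurability at once, and \<open>tail\<close>
  is stated for sums to avoid both the supremum and division by \<open>n\<close>.\<close>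

locale cesaro_dominated = prob_space +
  fixes X :: "nat \<Rightarrow> 'a \<Rightarrow> real" and h :: "real \<Rightarrow> real"
  assumes meas: "\<And>n. n \<ge> 1 \<Longrightarrow> X n \<in> borel_measurable M"
    and nonneg: "\<And>n \<omega>. n \<ge> 1 \<Longrightarrow> 0 \<le> X n \<omega>"
    and indep: "pairwise (\<lambda>i j. indep_var borel (X i) borel (X j)) {1..}"
    and antimono_h: "antimono h"
    and finite_h: "(\<integral>\<^sup>+x\<in>{0..}. ennreal (h x) \<partial>lborel) < \<infinity>"
    and tail: "\<And>n x. x \<ge> 0 \<Longrightarrow> (\<Sum>k=1..n. prob {\<omega> \<in> space M. x < X k \<omega>}) \<le> n * h x"
begin

lemma h_nonneg: "0 \<le> h x"
proof -
  have "0 \<le> prob {\<omega> \<in> space M. max x 0 < X 1 \<omega>}"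
    by simp
  also have "\<dots> \<le> h (max x 0)"
    using tail[of "max x 0" 1] by simp
  also have "\<dots> \<le> h x"
    by (rule antimonoD[OF antimono_h]) simp
  finally show ?thesis .
qed

lemma h_measurable [measurable]: "h \<in> borel_measurable borel"
proof -
  have "(\<lambda>x. - h x) \<in> borel_measurable borel"
    using antimono_h by (intro borel_measurable_mono) (auto simp: mono_def antimono_def)
  then show ?thesis
    by (simp add: borel_measurable_uminus_eq)
qed

text \<open>The bound \<open>n * h x\<close> concerns the sum of the tails, so the sum is moved
  inside the integral before \<open>tail\<close> is applied. Vanishing of \<open>g\<close> on
  negative arguments matches the range \<open>x \<ge> 0\<close> of \<open>tail\<close>.\<close>

lemma sum_layer_cake_le:
  fixes g :: "real \<Rightarrow> ennreal"
  assumes [measurable]: "g \<in> borel_measurable borel" and g: "\<And>x. x < 0 \<Longrightarrow> g x = 0"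
  shows "(\<Sum>k=1..n. \<integral>\<^sup>+\<omega>. \<integral>\<^sup>+x. g x * indicator {..<X k \<omega>} x \<partial>lborel \<partial>M)
      \<le> ennreal n * (\<integral>\<^sup>+x. g x * ennreal (h x) \<partial>lborel)"
proof -
  have m: "(\<lambda>x. g x * emeasure M {\<omega> \<in> space M. x < X k \<omega>}) \<in> borel_measurable lborel"
    if "k \<in> {1..n}" for k
  proof -
    have [measurable]: "X k \<in> borel_measurable M"
      using that by (intro meas) simp
    show ?thesis by measurable
  qed
  have "(\<Sum>k=1..n. \<integral>\<^sup>+\<omega>. \<integral>\<^sup>+x. g x * indicator {..<X k \<omega>} x \<partial>lborel \<partial>M)
      = (\<Sum>k=1..n. \<integral>\<^sup>+x. g x * emeasure M {\<omega> \<in> space M. x < X k \<omega>} \<partial>lborel)"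
    by (intro sum.cong nn_integral_layer_cake) (auto simp: meas)
  also have "\<dots> = (\<integral>\<^sup>+x. (\<Sum>k=1..n. g x * emeasure M {\<omega> \<in> space M. x < X k \<omega>}) \<partial>lborel)"
    by (rule nn_integral_sum[symmetric]) (rule m)
  also have "\<dots> \<le> (\<integral>\<^sup>+x. ennreal n * (g x * ennreal (h x)) \<partial>lborel)"
  proof (rule nn_integral_mono)
    fix x :: real
    show "(\<Sum>k=1..n. g x * emeasure M {\<omega> \<in> space M. x < X k \<omega>}) \<le> ennreal n * (g x * ennreal (h x))"
    proof (cases "x < 0")
      case True
      then show ?thesis by (simp add: g)
    next
      case False
      have "(\<Sum>k=1..n. g x * emeasure M {\<omega> \<in> space M. x < X k \<omega>})
          = g x * ennreal (\<Sum>k=1..n. prob {\<omega> \<in> space M. x < X k \<omega>})"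
        by (simp add: emeasure_eq_measure sum_distrib_left[symmetric] sum_ennreal)
      also have "\<dots> \<le> g x * ennreal (n * h x)"
        using False by (intro mult_left_mono ennreal_leI tail) auto
      also have "\<dots> = ennreal n * (g x * ennreal (h x))"
        by (simp add: ennreal_mult h_nonneg mult_ac)
      finally show ?thesis .
    qed
  qed
  also have "\<dots> = ennreal n * (\<integral>\<^sup>+x. g x * ennreal (h x) \<partial>lborel)"
    by (rule nn_integral_cmult) measurable
  finally show ?thesis .
qed

section \<open>Tail integrals of \<open>h\<close> and expected excesses\<close>

text \<open>Real-valued for comparison with expectations. Since \<open>enn2real\<close> sends
  infinity to 0, \<open>ennreal_R\<close> first checks finiteness for
  \<open>a \<ge> 0\<close>.\<close>

definition R :: "real \<Rightarrow> real" where
  "R a = enn2real (\<integral>\<^sup>+x. indicator {a..} x * ennreal (h x) \<partial>lborel)"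

lemma ennreal_R: "a \<ge> 0 \<Longrightarrow> ennreal (R a) = (\<integral>\<^sup>+x. indicator {a..} x * ennreal (h x) \<partial>lborel)"
proof -
  assume "a \<ge> 0"
  then have "(\<integral>\<^sup>+x. indicator {a..} x * ennreal (h x) \<partial>lborel) \<le> (\<integral>\<^sup>+x\<in>{0..}. ennreal (h x) \<partial>lborel)"
    by (intro nn_integral_mono) (auto simp: indicator_def)
  then show ?thesis
    unfolding R_def using finite_h by (intro ennreal_enn2real) (auto simp: le_less_trans)
qed

lemma R_nonneg: "0 \<le> R a"
  by (simp add: R_def)

text \<open>Dominated convergence along integer levels: the indicators of \<open>{real i..}\<close>
  vanish pointwise, with \<open>h\<close> on the half-line as dominating function.\<close>

lemma ex_R_less:
  fixes r :: real
  assumes "r > 0"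
  shows "\<exists>a\<ge>0. R a < r"
proof -
  have "(\<lambda>i. \<integral>\<^sup>+x. indicator {real i..} x * ennreal (h x) \<partial>lborel) \<longlonglongrightarrow> (\<integral>\<^sup>+(x::real). 0 \<partial>lborel)"
  proof (rule nn_integral_dominated_convergence[where w = "\<lambda>x. ennreal (h x) * indicator {0..} x"])
    show "AE x in lborel. (\<lambda>i. indicator {real i..} x * ennreal (h x)) \<longlonglongrightarrow> 0"
    proof (rule AE_I2)
      fix x :: real
      obtain N where "x < real N"
        using reals_Archimedean2 by blast
      then have "eventually (\<lambda>i. indicator {real i..} x * ennreal (h x) = 0) sequentially"
        by (intro eventually_sequentiallyI[of N]) (auto simp: indicator_def)
      then show "(\<lambda>i. indicator {real i..} x * ennreal (h x)) \<longlonglongrightarrow> 0"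
        by (rule tendsto_eventually)
    qed
  qed (use finite_h in \<open>auto simp: indicator_def\<close>)
  then have "(\<lambda>i. ennreal (R (real i))) \<longlonglongrightarrow> ennreal 0"
    by (simp add: ennreal_R)
  then have "eventually (\<lambda>i. ennreal (R (real i)) < ennreal r) sequentially"
    using assms by (intro order_tendstoD) auto
  then obtain i where "ennreal (R (real i)) < ennreal r"
    by (auto simp: eventually_sequentially)
  then show ?thesis
    using R_nonneg by (intro exI[of _ "real i"]) (auto simp: ennreal_less_iff)
qed

text \<open>With \<open>ex_R_less\<close>, this is a Cesaro form of uniform integrability: the
  averaged excess over \<open>a\<close> is small uniformly in \<open>n\<close> once \<open>a\<close>
  is large.\<close>

lemma sum_nn_excess_le:
  assumes "a \<ge> 0"
  shows "(\<Sum>k=1..n. \<integral>\<^sup>+\<omega>. ennreal (max 0 (X k \<omega> - a)) \<partial>M) \<le> ennreal (n * R a)"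
  using sum_layer_cake_le[of "indicator {a..}" n] assms
  by (simp add: nn_integral_indicator_excess ennreal_R[symmetric] ennreal_mult R_nonneg)

lemma excess_integrable:
  assumes "k \<ge> 1" "a \<ge> 0"
  shows "integrable M (\<lambda>\<omega>. max 0 (X k \<omega> - a))"
proof (rule integrableI_nonneg)
  show "(\<lambda>\<omega>. max 0 (X k \<omega> - a)) \<in> borel_measurable M"
    using meas[OF assms(1)] by measurable
  \<comment> \<open>A single term is bounded by the sum up to its own index. In that sum the bound
    variable \<open>k\<close> shadows the fixed \<open>k\<close>, which is the upper limit.\<close>
  have "(\<integral>\<^sup>+\<omega>. ennreal (max 0 (X k \<omega> - a)) \<partial>M)
      \<le> (\<Sum>k=1..k. \<integral>\<^sup>+\<omega>. ennreal (max 0 (X k \<omega> - a)) \<partial>M)"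
    using assms by (intro member_le_sum) auto
  also have "\<dots> < \<infinity>"
    using sum_nn_excess_le[OF assms(2), of k] by (simp add: le_less_trans)
  finally show "(\<integral>\<^sup>+\<omega>. ennreal (max 0 (X k \<omega> - a)) \<partial>M) < \<infinity>" .
qed simp

lemma X_integrable: "k \<ge> 1 \<Longrightarrow> integrable M (X k)"
  using excess_integrable[of k 0] nonneg by (simp add: max_absorb2)

lemma sum_excess_le:
  assumes "a \<ge> 0"
  shows "(\<Sum>k=1..n. expectation (\<lambda>\<omega>. max 0 (X k \<omega> - a))) \<le> n * R a"
proof -
  have "ennreal (\<Sum>k=1..n. expectation (\<lambda>\<omega>. max 0 (X k \<omega> - a)))
      = (\<Sum>k=1..n. ennreal (expectation (\<lambda>\<omega>. max 0 (X k \<omega> - a))))"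
    by (rule sum_ennreal[symmetric]) simp
  also have "\<dots> = (\<Sum>k=1..n. \<integral>\<^sup>+\<omega>. ennreal (max 0 (X k \<omega> - a)) \<partial>M)"
    using assms by (intro sum.cong nn_integral_eq_integral[symmetric] excess_integrable) auto
  also have "\<dots> \<le> ennreal (n * R a)"
    by (rule sum_nn_excess_le[OF assms])
  finally show ?thesis
    by (simp add: R_nonneg)
qed

section \<open>Truncation and second moments\<close>

text \<open>Capping at \<open>k\<close>, rather than replacing large values by 0, makes the
  truncated variable increase with the level and gives its square a direct layer-cake bound.\<close>

definition Y :: "nat \<Rightarrow> 'a \<Rightarrow> real" where
  "Y k \<omega> = min (X k \<omega>) k"

lemma Y_meas: "k \<ge> 1 \<Longrightarrow> Y k \<in> borel_measurable M"
  using meas[of k] unfolding Y_def[abs_def] by measurable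

lemma Y_nonneg: "k \<ge> 1 \<Longrightarrow> 0 \<le> Y k \<omega>"
  using nonneg[of k \<omega>] by (simp add: Y_def)

lemma Y_integrable: "k \<ge> 1 \<Longrightarrow> integrable M (Y k)"
  using Y_meas[of k] Y_nonneg[of k] by (intro integrable_const_bound[of _ "real k"]) (auto simp: Y_def)

lemma Y_square_integrable:
  assumes "k \<ge> 1"
  shows "integrable M (\<lambda>\<omega>. (Y k \<omega>)\<^sup>2)"
proof (rule integrable_const_bound[of _ "(real k)\<^sup>2"])
  show "AE \<omega> in M. norm ((Y k \<omega>)\<^sup>2) \<le> (real k)\<^sup>2"
    using Y_nonneg[OF assms] by (auto simp: Y_def intro!: power_mono)
  show "(\<lambda>\<omega>. (Y k \<omega>)\<^sup>2) \<in> borel_measurable M"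
    using Y_meas[OF assms] by measurable
qed

lemma Y_indep: "pairwise (\<lambda>i j. indep_var borel (Y i) borel (Y j)) {1..}"
proof (rule pairwiseI)
  fix i j :: nat
  assume "i \<in> {1..}" "j \<in> {1..}" "i \<noteq> j"
  then have "indep_var borel (X i) borel (X j)"
    using indep by (auto simp: pairwise_def)
  then have "indep_var borel ((\<lambda>x. min x (real i)) \<circ> X i) borel ((\<lambda>x. min x (real j)) \<circ> X j)"
    by (rule indep_var_compose) measurable
  then show "indep_var borel (Y i) borel (Y j)"
    by (simp add: Y_def[abs_def] comp_def)
qed

text \<open>For \<open>k \<le> n\<close> the level \<open>k\<close> is raised to \<open>n\<close>,
  so that a single weight serves all \<open>k\<close> and \<open>sum_layer_cake_le\<close>
  applies.\<close>

lemma sum_Y_square_le: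
  "(\<Sum>k=1..n. \<integral>\<^sup>+\<omega>. ennreal ((Y k \<omega>)\<^sup>2) \<partial>M)
     \<le> ennreal n * (\<integral>\<^sup>+x. ennreal (2 * x) * indicator {0..real n} x * ennreal (h x) \<partial>lborel)"
proof -
  have "ennreal ((Y k \<omega>)\<^sup>2) \<le> (\<integral>\<^sup>+x. ennreal (2 * x) * indicator {0..real n} x * indicator {..<X k \<omega>} x \<partial>lborel)"
    if "k \<in> {1..n}" for k \<omega>
  proof -
    have "(Y k \<omega>)\<^sup>2 \<le> (min (X k \<omega>) (real n))\<^sup>2"
      using that nonneg[of k \<omega>] by (intro power_mono) (auto simp: Y_def)
    then have "ennreal ((Y k \<omega>)\<^sup>2) \<le> ennreal ((min (X k \<omega>) (real n))\<^sup>2)"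
      by (rule ennreal_leI)
    also have "\<dots> \<le> (\<integral>\<^sup>+x. ennreal (2 * x) * indicator {0..real n} x * indicator {..<X k \<omega>} x \<partial>lborel)"
      using that nonneg[of k \<omega>] by (intro square_min_le_nn_integral) auto
    finally show ?thesis .
  qed
  then have "(\<Sum>k=1..n. \<integral>\<^sup>+\<omega>. ennreal ((Y k \<omega>)\<^sup>2) \<partial>M)
      \<le> (\<Sum>k=1..n. \<integral>\<^sup>+\<omega>. \<integral>\<^sup>+x. ennreal (2 * x) * indicator {0..real n} x * indicator {..<X k \<omega>} x \<partial>lborel \<partial>M)"
    by (intro sum_mono nn_integral_mono) auto
  also have "\<dots> \<le> ennreal n * (\<integral>\<^sup>+x. ennreal (2 * x) * indicator {0..real n} x * ennreal (h x) \<partial>lborel)"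
    by (rule sum_layer_cake_le) (auto simp: indicator_def)
  finally show ?thesis .
qed

text \<open>This serves twice: with \<open>c = 2\<close> for the variances along a geometric
  subsequence, and with \<open>\<alpha> = 2\<close>, \<open>c = 1\<close> for the dyadic blocks that
  compare \<open>X\<close> with \<open>Y\<close>.\<close>

lemma suminf_weighted_finite:
  fixes \<alpha> c :: real
  assumes "\<alpha> > 1" "c > 0"
  shows "(\<Sum>n. ennreal (1 / \<alpha> ^ n) *
           (\<integral>\<^sup>+x. ennreal (2 * x) * indicator {0..c * \<alpha> ^ n} x * ennreal (h x) \<partial>lborel)) < \<infinity>"
proof -
  have "ennreal (2 * c * \<alpha> / (\<alpha> - 1)) * (\<integral>\<^sup>+x\<in>{0..}. ennreal (h x) \<partial>lborel) < \<infinity>"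
    using finite_h by (simp add: ennreal_mult_less_top)
  with suminf_weighted_integral_le[OF h_measurable assms h_nonneg] show ?thesis
    by (rule le_less_trans)
qed

lemma nn_integral_square_average_le:
  assumes "n \<ge> 1"
  shows "(\<integral>\<^sup>+\<omega>. ennreal ((((\<Sum>k=1..n. Y k \<omega>) - (\<Sum>k=1..n. expectation (Y k))) / n)\<^sup>2) \<partial>M)
    \<le> ennreal (1 / n) * (\<integral>\<^sup>+x. ennreal (2 * x) * indicator {0..real n} x * ennreal (h x) \<partial>lborel)"
proof -
  let ?D = "\<lambda>\<omega>. (\<Sum>k=1..n. Y k \<omega>) - (\<Sum>k=1..n. expectation (Y k))"
  let ?J = "\<integral>\<^sup>+x. ennreal (2 * x) * indicator {0..real n} x * ennreal (h x) \<partial>lborel"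
  have "pairwise (\<lambda>i j. indep_var borel (Y i) borel (Y j)) {1..n}"
    using Y_indep by (rule pairwise_subset) auto
  note * = expectation_square_centered_sum_le[of "{1..n}" Y, OF _ _ _ this]
  have int: "integrable M (\<lambda>\<omega>. (?D \<omega>)\<^sup>2)"
    using Y_meas Y_square_integrable by (intro *(1)) auto
  have le: "expectation (\<lambda>\<omega>. (?D \<omega>)\<^sup>2) \<le> (\<Sum>k=1..n. expectation (\<lambda>\<omega>. (Y k \<omega>)\<^sup>2))"
    using Y_meas Y_square_integrable by (intro *(2)) auto
  have "(\<integral>\<^sup>+\<omega>. ennreal ((?D \<omega>)\<^sup>2) \<partial>M) = ennreal (expectation (\<lambda>\<omega>. (?D \<omega>)\<^sup>2))"
    by (rule nn_integral_eq_integral[OF int]) simp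
  also have "\<dots> \<le> ennreal (\<Sum>k=1..n. expectation (\<lambda>\<omega>. (Y k \<omega>)\<^sup>2))"
    by (rule ennreal_leI[OF le])
  also have "\<dots> = (\<Sum>k=1..n. ennreal (expectation (\<lambda>\<omega>. (Y k \<omega>)\<^sup>2)))"
    by (rule sum_ennreal[symmetric]) simp
  also have "\<dots> = (\<Sum>k=1..n. \<integral>\<^sup>+\<omega>. ennreal ((Y k \<omega>)\<^sup>2) \<partial>M)"
    by (intro sum.cong nn_integral_eq_integral[symmetric] Y_square_integrable) auto
  also have "\<dots> \<le> ennreal n * ?J"
    by (rule sum_Y_square_le)
  finally have main: "(\<integral>\<^sup>+\<omega>. ennreal ((?D \<omega>)\<^sup>2) \<partial>M) \<le> ennreal n * ?J" .
  have "(\<integral>\<^sup>+\<omega>. ennreal ((?D \<omega> / n)\<^sup>2) \<partial>M) = (\<integral>\<^sup>+\<omega>. ennreal (1 / (real n)\<^sup>2) * ennreal ((?D \<omega>)\<^sup>2) \<partial>M)"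
    by (intro nn_integral_cong) (simp add: ennreal_mult[symmetric] power_divide)
  also have "\<dots> = ennreal (1 / (real n)\<^sup>2) * (\<integral>\<^sup>+\<omega>. ennreal ((?D \<omega>)\<^sup>2) \<partial>M)"
    by (intro nn_integral_cmult measurable_compose[OF _ measurable_ennreal] borel_measurable_integrable int)
  also have "\<dots> \<le> ennreal (1 / (real n)\<^sup>2) * (ennreal n * ?J)"
    by (rule mult_left_mono[OF main]) simp
  also have "\<dots> = ennreal (1 / (real n)\<^sup>2 * n) * ?J"
    by (simp only: ennreal_mult mult.assoc of_nat_0_le_iff zero_le_divide_1_iff zero_le_power2)
  also have "1 / (real n)\<^sup>2 * n = 1 / n"
    by (simp add: power2_eq_square)
  finally show ?thesis .
qed

section \<open>Convergence of the truncated averages\<close>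

lemma AE_average_subsequence:
  fixes \<alpha> :: real
  assumes "\<alpha> > 1"
  shows "AE \<omega> in M. (\<lambda>i. ((\<Sum>k=1..nat \<lceil>\<alpha> ^ i\<rceil>. Y k \<omega>) - (\<Sum>k=1..nat \<lceil>\<alpha> ^ i\<rceil>. expectation (Y k)))
                             / real (nat \<lceil>\<alpha> ^ i\<rceil>)) \<longlonglongrightarrow> 0"
proof (rule AE_tendsto_zero_of_suminf_square)
  fix i
  show "(\<lambda>\<omega>. ((\<Sum>k=1..nat \<lceil>\<alpha> ^ i\<rceil>. Y k \<omega>) - (\<Sum>k=1..nat \<lceil>\<alpha> ^ i\<rceil>. expectation (Y k)))
                             / real (nat \<lceil>\<alpha> ^ i\<rceil>)) \<in> borel_measurable M"
    using Y_meas by (intro borel_measurable_divide borel_measurable_diff borel_measurable_sum) auto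
next
  let ?N = "\<lambda>i. nat \<lceil>\<alpha> ^ i\<rceil>"
  let ?J = "\<lambda>b. \<integral>\<^sup>+x. ennreal (2 * x) * indicator {0..b} x * ennreal (h x) \<partial>lborel"
  have "(\<integral>\<^sup>+\<omega>. ennreal ((((\<Sum>k=1..?N i. Y k \<omega>) - (\<Sum>k=1..?N i. expectation (Y k))) / ?N i)\<^sup>2) \<partial>M)
      \<le> ennreal (1 / \<alpha> ^ i) * ?J (2 * \<alpha> ^ i)" (is "?L i \<le> _") for i
  proof -
    have 1: "1 \<le> \<alpha> ^ i"
      using assms by simp
    \<comment> \<open>As \<open>\<alpha> ^ i \<ge> 1\<close>, rounding up at most doubles it; hence
      the constant \<open>c = 2\<close> below.\<close>
    then have N: "1 \<le> ?N i" "\<alpha> ^ i \<le> ?N i" "?N i \<le> 2 * \<alpha> ^ i"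
      by linarith+
    have "?L i \<le> ennreal (1 / ?N i) * ?J (real (?N i))"
      by (rule nn_integral_square_average_le[OF N(1)])
    also have "\<dots> \<le> ennreal (1 / \<alpha> ^ i) * ?J (2 * \<alpha> ^ i)"
    proof (rule mult_mono)
      show "ennreal (1 / ?N i) \<le> ennreal (1 / \<alpha> ^ i)"
        using N 1 by (intro ennreal_leI divide_left_mono) auto
      show "?J (real (?N i)) \<le> ?J (2 * \<alpha> ^ i)"
        using N(3) by (intro nn_integral_mono) (auto simp: indicator_def)
    qed auto
    finally show ?thesis .
  qed
  then have "suminf ?L \<le> (\<Sum>i. ennreal (1 / \<alpha> ^ i) * ?J (2 * \<alpha> ^ i))"
    by (intro suminf_le) auto
  also have "\<dots> < \<infinity>"
    using assms by (intro suminf_weighted_finite) auto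
  finally show "suminf ?L < \<infinity>" .
qed

lemma expectation_Y_nonneg: "k \<ge> 1 \<Longrightarrow> 0 \<le> expectation (Y k)"
  using Y_nonneg by simp

text \<open>Each \<open>expectation (Y k)\<close> is at most \<open>A\<close> plus the expected
  excess of \<open>X k\<close> over \<open>A\<close>. The excesses over \<open>{m<..n}\<close> are
  enlarged to the sum over \<open>{1..n}\<close>, where the averaged bound applies; hence the error
  \<open>r * real n\<close> instead of \<open>r * real (n - m)\<close>.\<close>

lemma expectation_Y_oscillation:
  fixes r :: real
  assumes "r > 0"
  shows "\<exists>A\<ge>0. \<forall>m n. m \<le> n \<longrightarrow>
    (\<Sum>k=1..n. expectation (Y k)) - (\<Sum>k=1..m. expectation (Y k)) \<le> A * real (n - m) + r * real n"
proof -
  obtain A where A: "A \<ge> 0" "R A < r"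
    using ex_R_less[OF assms] by blast
  show ?thesis
  proof (intro exI[of _ A] conjI allI impI A(1))
    fix m n :: nat
    assume mn: "m \<le> n"
    have le: "expectation (Y k) \<le> A + expectation (\<lambda>\<omega>. max 0 (X k \<omega> - A))" if "k \<ge> 1" for k
    proof -
      have "expectation (Y k) \<le> expectation (\<lambda>\<omega>. A + max 0 (X k \<omega> - A))"
        using that excess_integrable[OF that A(1)]
        by (intro integral_mono Y_integrable) (auto simp: Y_def)
      also have "\<dots> = A + expectation (\<lambda>\<omega>. max 0 (X k \<omega> - A))"
        using excess_integrable[OF that A(1)] by (simp add: prob_space)
      finally show ?thesis .
    qed
    have "{1..n} = {1..m} \<union> {m<..n}" "{1..m} \<inter> {m<..n} = {}"
      using mn by auto
    then have "(\<Sum>k=1..n. expectation (Y k)) = (\<Sum>k=1..m. expectation (Y k)) + (\<Sum>k\<in>{m<..n}. expectation (Y k))"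
      by (simp add: sum.union_disjoint)
    moreover have "(\<Sum>k\<in>{m<..n}. expectation (Y k)) \<le> A * real (n - m) + r * real n"
    proof -
      have "(\<Sum>k\<in>{m<..n}. expectation (Y k)) \<le> (\<Sum>k\<in>{m<..n}. A + expectation (\<lambda>\<omega>. max 0 (X k \<omega> - A)))"
        by (intro sum_mono le) auto
      also have "\<dots> = A * real (n - m) + (\<Sum>k\<in>{m<..n}. expectation (\<lambda>\<omega>. max 0 (X k \<omega> - A)))"
        by (simp add: sum.distrib)
      also have "(\<Sum>k\<in>{m<..n}. expectation (\<lambda>\<omega>. max 0 (X k \<omega> - A)))
          \<le> (\<Sum>k=1..n. expectation (\<lambda>\<omega>. max 0 (X k \<omega> - A)))"
        by (intro sum_mono2) auto
      also have "\<dots> \<le> n * R A"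
        by (rule sum_excess_le[OF A(1)])
      also have "\<dots> \<le> r * n"
        using mult_left_mono[of "R A" r "real n"] A(2) by (simp add: mult.commute)
      finally show ?thesis by simp
    qed
    ultimately show "(\<Sum>k=1..n. expectation (Y k)) - (\<Sum>k=1..m. expectation (Y k)) \<le> A * real (n - m) + r * real n"
      by linarith
  qed
qed

lemma AE_truncated_average:
  "AE \<omega> in M. (\<lambda>n. ((\<Sum>k=1..n. Y k \<omega>) - (\<Sum>k=1..n. expectation (Y k))) / n) \<longlonglongrightarrow> 0"
proof -
  have mono: "mono (\<lambda>n::nat. \<Sum>k=1..n. f k)" if "\<And>k. k \<ge> 1 \<Longrightarrow> (0::real) \<le> f k" for f
    using that by (intro monoI sum_mono2) auto
  have "AE \<omega> in M. \<forall>j. (\<lambda>i. ((\<Sum>k=1..nat \<lceil>(1 + 1 / Suc j) ^ i\<rceil>. Y k \<omega>)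
      - (\<Sum>k=1..nat \<lceil>(1 + 1 / Suc j) ^ i\<rceil>. expectation (Y k))) / real (nat \<lceil>(1 + 1 / Suc j) ^ i\<rceil>)) \<longlonglongrightarrow> 0"
    by (subst AE_all_countable, intro allI AE_average_subsequence) simp
  then show ?thesis
  proof eventually_elim
    case (elim \<omega>)
    show ?case
    proof (rule geometric_subsequence_sandwich)
      show "mono (\<lambda>n. \<Sum>k=1..n. Y k \<omega>)" "mono (\<lambda>n. \<Sum>k=1..n. expectation (Y k))"
        by (intro mono Y_nonneg expectation_Y_nonneg; assumption)+
    qed (use elim expectation_Y_oscillation in blast)+
  qed
qed

section \<open>Removing the truncation\<close>

lemma AE_eventually_Y_eq: "AE \<omega> in M. eventually (\<lambda>k. X k \<omega> = Y k \<omega>) sequentially"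
proof -
  \<comment> \<open>Monotonicity of \<open>h\<close> gives \<open>N h(N) \<le> (1/N) \<integral>\<^sub>0\<^sup>N 2 x h(x) dx\<close>, so the variance series also
    controls the dyadic blocks in the Borel-Cantelli argument.\<close>
  define B where "B m = (\<Union>k\<in>{2^m..<2^Suc m}. {\<omega> \<in> space M. real k < X k \<omega>})" for m
  have B: "B m \<in> sets M" for m
  proof -
    have "{\<omega> \<in> space M. real k < X k \<omega>} \<in> sets M" if "k \<in> {2^m..<2^Suc m}" for k
    proof -
      have "1 \<le> k"
        using that by (auto intro: order_trans[rotated])
      from meas[OF this] show ?thesis by measurable
    qed
    then show ?thesis
      unfolding B_def by (intro sets.finite_UN) auto
  qed
  let ?J = "\<lambda>b. \<integral>\<^sup>+x. ennreal (2 * x) * indicator {0..b} x * ennreal (h x) \<partial>lborel"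
  \<comment> \<open>The redundant factor in \<open>1 * 2 ^ m\<close> keeps the shape of
    \<open>suminf_weighted_finite\<close> with \<open>\<alpha> = 2\<close> and
    \<open>c = 1\<close>.\<close>
  have "ennreal (prob (B m)) \<le> 2 * (ennreal (1 / 2 ^ m) * ?J (1 * 2 ^ m))" for m
  proof -
    let ?x = "2 ^ m :: real"
    have ge1: "1 \<le> k" if "k \<in> {2^m..<2^Suc m}" for k :: nat
      using that by (auto intro: order_trans[rotated])
    have ms: "{\<omega> \<in> space M. x < X k \<omega>} \<in> sets M" if "1 \<le> k" for x k
      using meas[OF that] by measurable
    have "prob (B m) \<le> (\<Sum>k\<in>{2^m..<2^Suc m}. prob {\<omega> \<in> space M. real k < X k \<omega>})"
      unfolding B_def using ge1 ms by (intro finite_measure_subadditive_finite) auto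
    \<comment> \<open>Lowering every threshold to the left end of the block gives all tails the same
      argument, so \<open>tail\<close> applies once the sum is extended to all indices up to
      \<open>2 ^ Suc m\<close>.\<close>
    also have "\<dots> \<le> (\<Sum>k\<in>{2^m..<2^Suc m}. prob {\<omega> \<in> space M. ?x < X k \<omega>})"
    proof (intro sum_mono finite_measure_mono ms ge1)
      fix k :: nat
      assume "k \<in> {2^m..<2^Suc m}"
      then have "real (2 ^ m) \<le> real k"
        by (intro of_nat_mono) simp
      then have "?x \<le> real k"
        by simp
      then show "{\<omega> \<in> space M. real k < X k \<omega>} \<subseteq> {\<omega> \<in> space M. ?x < X k \<omega>}"
        by (blast intro: le_less_trans)
    qed
    also have "\<dots> \<le> (\<Sum>k=1..2^Suc m. prob {\<omega> \<in> space M. ?x < X k \<omega>})"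
      using ge1 by (intro sum_mono2) auto
    also have "\<dots> \<le> real (2 ^ Suc m) * h ?x"
      by (rule tail) simp
    finally have "ennreal (prob (B m)) \<le> ennreal (2 * (1 / 2 ^ m * (?x\<^sup>2 * h ?x)))"
      by (intro ennreal_leI) (simp add: power2_eq_square)
    also have "\<dots> = 2 * (ennreal (1 / 2 ^ m) * (ennreal (?x\<^sup>2) * ennreal (h ?x)))"
      by (simp only: ennreal_mult h_nonneg mult_nonneg_nonneg zero_le_numeral zero_le_divide_1_iff
          zero_le_power zero_le_power2 ennreal_numeral)
    also have "ennreal (?x\<^sup>2) * ennreal (h ?x) \<le> ?J ?x"
    proof -
      have "(\<integral>\<^sup>+x\<in>{0..?x}. ennreal (2 * x) \<partial>lborel) = ennreal (?x\<^sup>2 - 0\<^sup>2)"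
        by (intro nn_integral_FTC_Icc) (auto intro!: derivative_eq_intros)
      then have "ennreal (?x\<^sup>2) * ennreal (h ?x) = (\<integral>\<^sup>+x\<in>{0..?x}. ennreal (2 * x) \<partial>lborel) * ennreal (h ?x)"
        by simp
      also have "\<dots> = (\<integral>\<^sup>+x. ennreal (2 * x) * indicator {0..?x} x * ennreal (h ?x) \<partial>lborel)"
        by (rule nn_integral_multc[symmetric]) measurable
      also have "\<dots> \<le> ?J ?x"
        using antimonoD[OF antimono_h]
        by (intro nn_integral_mono) (auto simp: indicator_def intro!: mult_left_mono ennreal_leI)
      finally show ?thesis .
    qed
    finally show ?thesis
      by (simp add: mult_left_mono)
  qed
  then have "(\<Sum>m. ennreal (prob (B m))) \<le> (\<Sum>m. 2 * (ennreal (1 / 2 ^ m) * ?J (1 * 2 ^ m)))"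
    by (intro suminf_le) auto
  also have "\<dots> = 2 * (\<Sum>m. ennreal (1 / 2 ^ m) * ?J (1 * 2 ^ m))"
    by (rule ennreal_suminf_cmult)
  also have "\<dots> < \<infinity>"
    using suminf_weighted_finite[of 2 1] by (simp add: ennreal_mult_less_top)
  finally have "summable (\<lambda>m. prob (B m))"
    by (intro summable_suminf_not_top) auto
  then have "AE \<omega> in M. eventually (\<lambda>m. \<omega> \<in> space M - B m) sequentially"
    using B by (intro borel_cantelli_AE1) (auto simp: less_top[symmetric])
  then show ?thesis
  proof eventually_elim
    case (elim \<omega>)
    then obtain m0 where m0: "\<And>m. m \<ge> m0 \<Longrightarrow> \<omega> \<in> space M - B m"
      by (auto simp: eventually_sequentially)
    show ?case
    proof (rule eventually_sequentiallyI[of "2 ^ m0"])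
      fix k :: nat
      assume k: "2 ^ m0 \<le> k"
      have "0 < k"
        using k by (auto intro: less_le_trans[rotated])
      then have "k \<in> {2 ^ floor_log k..<2 ^ Suc (floor_log k)}"
        using floor_log_exp2_le[of k] floor_log_exp2_gt[of k] by simp
      moreover have "m0 \<le> floor_log k"
        using floor_log_mono[THEN monoD, OF k] by simp
      ultimately have "\<not> real k < X k \<omega>"
        using m0[of "floor_log k"] unfolding B_def by blast
      then show "X k \<omega> = Y k \<omega>"
        by (simp add: Y_def)
    qed
  qed
qed

text \<open>For \<open>k \<ge> A\<close> the loss \<open>X k - Y k\<close> is the excess over
  \<open>k\<close>, hence at most the excess over \<open>A\<close>. The finitely many earlier
  indices contribute a constant \<open>C\<close>, so the averaged bias is at most
  \<open>C / n + R A\<close>.\<close>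

lemma truncation_bias:
  "(\<lambda>n. ((\<Sum>k=1..n. expectation (X k)) - (\<Sum>k=1..n. expectation (Y k))) / n) \<longlonglongrightarrow> 0"
proof (rule LIMSEQ_I)
  fix r :: real
  assume r: "r > 0"
  obtain A where A: "A \<ge> 0" "R A < r / 2"
    using ex_R_less[of "r / 2"] r by auto
  define C where "C = (\<Sum>k=1..nat \<lceil>A\<rceil>. expectation (X k))"
  obtain N where N: "2 * C / r < real N"
    using reals_Archimedean2 by blast
  define d where "d k = expectation (X k) - expectation (Y k)" for k
  have d_nonneg: "0 \<le> d k" if "k \<ge> 1" for k
    using integral_mono[OF Y_integrable[OF that] X_integrable[OF that]] by (simp add: d_def Y_def)
  have d_le: "d k \<le> expectation (X k)" if "k \<ge> 1" for k
    using expectation_Y_nonneg[OF that] by (simp add: d_def)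
  have d_le2: "d k \<le> expectation (\<lambda>\<omega>. max 0 (X k \<omega> - A))" if "k \<ge> 1" "A \<le> k" for k
  proof -
    have "d k = expectation (\<lambda>\<omega>. X k \<omega> - Y k \<omega>)"
      unfolding d_def using X_integrable Y_integrable that by simp
    also have "\<dots> \<le> expectation (\<lambda>\<omega>. max 0 (X k \<omega> - A))"
      using X_integrable Y_integrable excess_integrable A that
      by (intro integral_mono) (auto simp: Y_def)
    finally show ?thesis .
  qed
  have main: "(\<Sum>k=1..n. d k) \<le> C + n * R A" for n
  proof -
    \<comment> \<open>Both bounds are nonnegative, so their sum covers early and late indices
      alike.\<close>
    have "(\<Sum>k=1..n. d k) \<le> (\<Sum>k=1..n. (if k \<le> nat \<lceil>A\<rceil> then expectation (X k) else 0)
              + expectation (\<lambda>\<omega>. max 0 (X k \<omega> - A)))"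
    proof (rule sum_mono)
      fix k
      assume "k \<in> {1..n}"
      then have k: "k \<ge> 1" by simp
      have "0 \<le> expectation (\<lambda>\<omega>. max 0 (X k \<omega> - A))"
        by simp
      moreover have "A \<le> k" if "\<not> k \<le> nat \<lceil>A\<rceil>"
        using that by linarith
      ultimately show "d k \<le> (if k \<le> nat \<lceil>A\<rceil> then expectation (X k) else 0)
              + expectation (\<lambda>\<omega>. max 0 (X k \<omega> - A))"
        using d_le[OF k] d_le2[OF k]
        by (cases "k \<le> nat \<lceil>A\<rceil>") (simp_all only: if_True if_False, linarith+)
    qed
    also have "\<dots> = (\<Sum>k\<in>{1..n} \<inter> {k. k \<le> nat \<lceil>A\<rceil>}. expectation (X k))
        + (\<Sum>k=1..n. expectation (\<lambda>\<omega>. max 0 (X k \<omega> - A)))"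
      by (simp add: sum.distrib sum.If_cases)
    also have "\<dots> \<le> C + n * R A"
      unfolding C_def using nonneg
      by (intro add_mono sum_mono2 sum_excess_le A(1)) (auto intro!: Bochner_Integration.integral_nonneg)
    finally show ?thesis .
  qed
  show "\<exists>n0. \<forall>n\<ge>n0. norm (((\<Sum>k=1..n. expectation (X k)) - (\<Sum>k=1..n. expectation (Y k))) / n - 0) < r"
  proof (intro exI[of _ "Suc N"] allI impI)
    fix n
    assume n: "Suc N \<le> n"
    have "C < r / 2 * n"
    proof -
      have "2 * C / r < n"
        using N n by linarith
      then show ?thesis
        using r by (simp add: field_simps)
    qed
    moreover have "n * R A \<le> r / 2 * n"
      using mult_left_mono[of "R A" "r / 2" "real n"] A(2) by (simp add: mult.commute)
    ultimately have "(\<Sum>k=1..n. d k) < r * n"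
      using main[of n] by (simp add: field_simps)
    moreover have "0 \<le> (\<Sum>k=1..n. d k)"
      by (intro sum_nonneg d_nonneg) auto
    ultimately have "\<bar>(\<Sum>k=1..n. d k) / n\<bar> < r"
      using n by (simp add: field_simps)
    then show "norm (((\<Sum>k=1..n. expectation (X k)) - (\<Sum>k=1..n. expectation (Y k))) / n - 0) < r"
      by (simp add: d_def sum_subtractf)
  qed
qed

text \<open>Almost surely the partial sums of \<open>X\<close> and \<open>Y\<close> eventually
  differ by a constant \<open>c\<close>, which vanishes after division by \<open>n\<close>. The
  deviation of \<open>X\<close> is this difference plus the truncated deviation minus the truncation
  bias.\<close>

theorem strong_law:
  "AE \<omega> in M. (\<lambda>n. ((\<Sum>k=1..n. X k \<omega>) - (\<Sum>k=1..n. expectation (X k))) / n) \<longlonglongrightarrow> 0"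
  using AE_truncated_average AE_eventually_Y_eq
proof eventually_elim
  case (elim \<omega>)
  obtain N where N: "\<And>k. k \<ge> N \<Longrightarrow> X k \<omega> = Y k \<omega>"
    using elim(2) by (auto simp: eventually_sequentially)
  define c where "c = (\<Sum>k=1..N. X k \<omega> - Y k \<omega>)"
  have "eventually (\<lambda>n. c / real n = ((\<Sum>k=1..n. X k \<omega>) - (\<Sum>k=1..n. Y k \<omega>)) / n) sequentially"
  proof (rule eventually_sequentiallyI[of N])
    fix n
    assume "N \<le> n"
    then have "(\<Sum>k=1..n. X k \<omega> - Y k \<omega>) = c"
      unfolding c_def using N by (intro sum.mono_neutral_right) auto
    then show "c / real n = ((\<Sum>k=1..n. X k \<omega>) - (\<Sum>k=1..n. Y k \<omega>)) / n"
      by (simp add: sum_subtractf)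
  qed
  moreover have "(\<lambda>n. c / real n) \<longlonglongrightarrow> 0"
    by (rule lim_const_over_n)
  ultimately have "(\<lambda>n. ((\<Sum>k=1..n. X k \<omega>) - (\<Sum>k=1..n. Y k \<omega>)) / n) \<longlonglongrightarrow> 0"
    by (rule Lim_transform_eventually[rotated])
  from tendsto_diff[OF tendsto_add[OF this elim(1)] truncation_bias]
  show ?case
    by (simp add: diff_divide_distrib add_divide_distrib)
qed

end

section \<open>Real-valued variables through positive and negative parts\<close>

theorem theorem2:
  fixes M :: "'a measure" and X :: "nat \<Rightarrow> 'a \<Rightarrow> real" and H :: "real \<Rightarrow> real"
  assumes "prob_space M"
    and "\<And>n. n \<ge> 1 \<Longrightarrow> X n \<in> borel_measurable M"
    and "pairwise (\<lambda>i j. prob_space.indep_var M borel (X i) borel (X j)) {1..}"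
    and "antimono_on {0..} H"
    and "(\<integral>\<^sup>+x\<in>{0..}. ennreal (H x) \<partial>lborel) < \<infinity>"
    and "\<And>x. x \<ge> 0 \<Longrightarrow>
           (SUP n\<in>{1..}. (1 / real n) * (\<Sum>k=1..n. measure M {\<omega> \<in> space M. \<bar>X k \<omega>\<bar> > x})) \<le> H x"
  shows "AE \<omega> in M.
           (\<lambda>n. ((\<Sum>k=1..n. X k \<omega>) - (\<integral>\<omega>'. (\<Sum>k=1..n. X k \<omega>') \<partial>M)) / real n) \<longlonglongrightarrow> 0"
proof -
  interpret prob_space M by fact
  \<comment> \<open>The constant extension to the left keeps \<open>H\<close> on the half-line and
    is monotone everywhere, as the locale demands.\<close>
  define h where "h x = H (max 0 x)" for x
  have h_anti: "antimono h"
    using assms(4) by (auto simp: h_def antimono_def monotone_on_def)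
  have h_fin: "(\<integral>\<^sup>+x\<in>{0..}. ennreal (h x) \<partial>lborel) < \<infinity>"
  proof -
    have "(\<integral>\<^sup>+x\<in>{0..}. ennreal (h x) \<partial>lborel) = (\<integral>\<^sup>+x\<in>{0..}. ennreal (H x) \<partial>lborel)"
      by (intro nn_integral_cong) (auto simp: h_def indicator_def)
    then show ?thesis
      using assms(5) by simp
  qed
  have abs_tail: "(\<Sum>k=1..n. prob {\<omega> \<in> space M. \<bar>X k \<omega>\<bar> > x}) \<le> n * h x" if "x \<ge> 0" for n x
  proof (cases "n = 0")
    case False
    let ?p = "\<lambda>n. (1 / real n) * (\<Sum>k=1..n. prob {\<omega> \<in> space M. \<bar>X k \<omega>\<bar> > x})"
    \<comment> \<open>A real supremum dominates its members only for a set bounded above; averages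
      of probabilities are at most 1.\<close>
    have "?p i \<le> 1" if "i \<in> {1..}" for i
      using that sum_bounded_above[of "{1..i}" "\<lambda>k. prob {\<omega> \<in> space M. \<bar>X k \<omega>\<bar> > x}" 1]
      by (simp add: field_simps)
    then have "bdd_above (?p ` {1..})"
      by (intro bdd_aboveI2[of _ _ 1])
    then have "?p n \<le> (SUP n\<in>{1..}. ?p n)"
      using False by (intro cSUP_upper) auto
    also have "\<dots> \<le> h x"
      using assms(6)[OF that] that by (simp add: h_def)
    finally show ?thesis
      using False by (simp add: field_simps)
  qed simp
  \<comment> \<open>Used for \<open>f\<close> the identity and for negation: either part exceeds a
    level \<open>x \<ge> 0\<close> only where \<open>\<bar>X k \<omega>\<bar>\<close> does.\<close>
  have part: "cesaro_dominated M (\<lambda>n \<omega>. max 0 (f (X n \<omega>))) h"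
    if [measurable]: "f \<in> borel_measurable borel" and f: "\<And>y::real. f y \<le> \<bar>y\<bar>" for f
  proof (unfold_locales)
    show "(\<lambda>\<omega>. max 0 (f (X n \<omega>))) \<in> borel_measurable M" if "n \<ge> 1" for n
      using assms(2)[OF that] by measurable
    show "pairwise (\<lambda>i j. indep_var borel (\<lambda>\<omega>. max 0 (f (X i \<omega>))) borel (\<lambda>\<omega>. max 0 (f (X j \<omega>)))) {1..}"
    proof (rule pairwiseI)
      fix i j :: nat
      assume "i \<in> {1..}" "j \<in> {1..}" "i \<noteq> j"
      then have "indep_var borel (X i) borel (X j)"
        using assms(3) by (auto simp: pairwise_def)
      then have "indep_var borel ((\<lambda>y. max 0 (f y)) \<circ> X i) borel ((\<lambda>y. max 0 (f y)) \<circ> X j)"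
        by (rule indep_var_compose) measurable
      then show "indep_var borel (\<lambda>\<omega>. max 0 (f (X i \<omega>))) borel (\<lambda>\<omega>. max 0 (f (X j \<omega>)))"
        by (simp add: comp_def)
    qed
    show "(\<Sum>k=1..n. prob {\<omega> \<in> space M. x < max 0 (f (X k \<omega>))}) \<le> n * h x" if "x \<ge> 0" for n x
    proof -
      have "(\<Sum>k=1..n. prob {\<omega> \<in> space M. x < max 0 (f (X k \<omega>))})
          \<le> (\<Sum>k=1..n. prob {\<omega> \<in> space M. \<bar>X k \<omega>\<bar> > x})"
      proof (intro sum_mono finite_measure_mono)
        fix k
        assume "k \<in> {1..n}"
        then have [measurable]: "X k \<in> borel_measurable M"
          using assms(2) by simp
        show "{\<omega> \<in> space M. \<bar>X k \<omega>\<bar> > x} \<in> sets M"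
          by measurable
        show "{\<omega> \<in> space M. x < max 0 (f (X k \<omega>))} \<subseteq> {\<omega> \<in> space M. \<bar>X k \<omega>\<bar> > x}"
          using that f by (auto simp: less_max_iff_disj intro: less_le_trans)
      qed
      also have "\<dots> \<le> n * h x"
        by (rule abs_tail[OF that])
      finally show ?thesis .
    qed
  qed (use h_anti h_fin in auto)
  interpret p: cesaro_dominated M "\<lambda>n \<omega>. max 0 (X n \<omega>)" h
    by (rule part) auto
  interpret q: cesaro_dominated M "\<lambda>n \<omega>. max 0 (- X n \<omega>)" h
    by (rule part) auto
  have dec: "X k = (\<lambda>\<omega>. max 0 (X k \<omega>) - max 0 (- X k \<omega>))" for k
    by (rule ext) simp
  \<comment> \<open>The Bochner integral of a nonintegrable function is 0 by convention, so
    integrability is needed before the expectation of the sum may be split.\<close>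
  have int: "integrable M (X k)" if "k \<ge> 1" for k
    by (subst dec[of k]) (intro Bochner_Integration.integrable_diff p.X_integrable q.X_integrable that)
  have EX: "expectation (X k) = expectation (\<lambda>\<omega>. max 0 (X k \<omega>)) - expectation (\<lambda>\<omega>. max 0 (- X k \<omega>))"
    if "k \<ge> 1" for k
    by (subst dec[of k]) (intro Bochner_Integration.integral_diff p.X_integrable q.X_integrable that)
  have E: "(\<integral>\<omega>'. (\<Sum>k=1..n. X k \<omega>') \<partial>M) = (\<Sum>k=1..n. expectation (\<lambda>\<omega>. max 0 (X k \<omega>)))
      - (\<Sum>k=1..n. expectation (\<lambda>\<omega>. max 0 (- X k \<omega>)))" for n
    by (simp add: Bochner_Integration.integral_sum int EX sum_subtractf)
  have S: "(\<Sum>k=1..n. X k \<omega>) = (\<Sum>k=1..n. max 0 (X k \<omega>)) - (\<Sum>k=1..n. max 0 (- X k \<omega>))" for n \<omega>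
    unfolding sum_subtractf[symmetric] by (intro sum.cong) auto
  show ?thesis
    using p.strong_law q.strong_law
  proof eventually_elim
    case (elim \<omega>)
    have "((\<Sum>k=1..n. X k \<omega>) - (\<integral>\<omega>'. (\<Sum>k=1..n. X k \<omega>') \<partial>M)) / real n
        = ((\<Sum>k=1..n. max 0 (X k \<omega>)) - (\<Sum>k=1..n. expectation (\<lambda>\<omega>. max 0 (X k \<omega>)))) / n
          - ((\<Sum>k=1..n. max 0 (- X k \<omega>)) - (\<Sum>k=1..n. expectation (\<lambda>\<omega>. max 0 (- X k \<omega>)))) / n" for n
      unfolding E unfolding S by (simp add: diff_divide_distrib)
    with tendsto_diff[OF elim] show ?case
      by simp
  qed
qed

end
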